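(* Let $n\ge 1$. There exists a non-involutive nontrivial regular Hom-Lie algebra structure on the Heisenberg Lie algebra $\mathfrak{h}_{2n+1}(\mathbb{C})$. As a result, $\mathrm{HLie}_i(\mathfrak{h}_{2n+1}(\mathbb{C}))$ is strictly contained in $\mathrm{HLie}_r(\mathfrak{h}_{2n+1}(\mathbb{C}))$.
   Context: $\mathfrak{h}_{2n+1}(\mathbb{C})$ is the complex Heisenberg Lie algebra with basis $z,x_1,y_1,\dots,x_n,y_n$ and brackets $[x_i,y_j]=\delta_{ij}z$, all other brackets of basis elements (up to antisymmetry) being zero. A linear map $D:\mathfrak{g}\to\mathfrak{g}$ on a finite-dimensional complex Lie algebra $\mathfrak{g}$ is a Hom-Lie algebra structure on $\mathfrak{g}$ if $[D(x),[y,w]]+[D(y),[w,x]]+[D(w),[x,y]]=0$ for all $x,y,w\in\mathfrak{g}$; it is multiplicative if moreover $D([x,y])=[D(x),D(y)]$ for all $x,y$. A multiplicative $D$ is regular if it is an automorphism of $\mathfrak{g}$, and involutive if $D^2=\mathrm{id}_{\mathfrak{g}}$. $\mathrm{HLie}_r(\mathfrak{g})$ and $\mathrm{HLie}_i(\mathfrak{g})$ denote the sets of regular and of involutive Hom-Lie algebra structures on $\mathfrak{g}$. Nontrivial means that $D$ is neither the zero map nor the identity. *)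

theory Defs
  imports "HOL-Analysis.Analysis"
begin

locale fd_complex_lie_algebra = vector_space scale
  for scale :: "complex \<Rightarrow> 'g::ab_group_add \<Rightarrow> 'g" +
  fixes bracket :: "'g \<Rightarrow> 'g \<Rightarrow> 'g"
  assumes finite_dim: "\<exists>B. finite B \<and> span B = UNIV"
    and bracket_linear_left: "\<And>y. Vector_Spaces.linear scale scale (\<lambda>x. bracket x y)"
    and bracket_linear_right: "\<And>x. Vector_Spaces.linear scale scale (bracket x)"
    and bracket_alternating: "\<And>x. bracket x x = 0"
    and jacobi: "\<And>x y w. bracket x (bracket y w) + bracket y (bracket w x) + bracket w (bracket x y) = 0"
begin

definition lie_automorphism :: "('g \<Rightarrow> 'g) \<Rightarrow> bool" where
  "lie_automorphism D \<longleftrightarrow>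
     Vector_Spaces.linear scale scale D \<and> bij D \<and>
     (\<forall>x y. D (bracket x y) = bracket (D x) (D y))"

definition hom_lie_structure :: "('g \<Rightarrow> 'g) \<Rightarrow> bool" where
  "hom_lie_structure D \<longleftrightarrow>
     Vector_Spaces.linear scale scale D \<and>
     (\<forall>x y w. bracket (D x) (bracket y w) + bracket (D y) (bracket w x)
              + bracket (D w) (bracket x y) = 0)"

definition multiplicative_hom_lie_structure :: "('g \<Rightarrow> 'g) \<Rightarrow> bool" where
  "multiplicative_hom_lie_structure D \<longleftrightarrow>
     hom_lie_structure D \<and> (\<forall>x y. D (bracket x y) = bracket (D x) (D y))"

definition regular_hom_lie_structure :: "('g \<Rightarrow> 'g) \<Rightarrow> bool" where
  "regular_hom_lie_structure D \<longleftrightarrow>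
     multiplicative_hom_lie_structure D \<and> lie_automorphism D"

definition involutive_hom_lie_structure :: "('g \<Rightarrow> 'g) \<Rightarrow> bool" where
  "involutive_hom_lie_structure D \<longleftrightarrow>
     multiplicative_hom_lie_structure D \<and> D \<circ> D = id"

definition HLie_r :: "('g \<Rightarrow> 'g) set" where
  "HLie_r = {D. regular_hom_lie_structure D}"

definition HLie_i :: "('g \<Rightarrow> 'g) set" where
  "HLie_i = {D. involutive_hom_lie_structure D}"

definition nontrivial :: "('g \<Rightarrow> 'g) \<Rightarrow> bool" where
  "nontrivial D \<longleftrightarrow> D \<noteq> (\<lambda>_. 0) \<and> D \<noteq> id"

end

text \<open>
  The Heisenberg Lie algebra of dimension \<open>2n + 1\<close> is the coordinate space whose
  coordinates are indexed by the names of the basis vectors \<open>z, x\<^sub>i, y\<^sub>i\<close>, where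
  \<open>i\<close> ranges over a finite type of cardinality \<open>n\<close>. As types are inhabited, \<open>n \<ge> 1\<close>.
\<close>

datatype 'n heis_index = Z | X 'n | Y 'n

lemma UNIV_heis_index: "UNIV = insert Z (range X \<union> range Y)"
proof (intro UNIV_eq_I)
  show "a \<in> insert Z (range X \<union> range Y)" for a :: "'n heis_index"
    by (cases a) auto
qed

instance heis_index :: (finite) finite
  by standard (simp add: UNIV_heis_index)

type_synonym 'n heisenberg = "(complex, 'n heis_index) vec"

text \<open>The bilinear extension of \<open>[x\<^sub>i, y\<^sub>j] = \<delta>\<^sub>i\<^sub>j z\<close>; its values on
  the basis are checked in \<open>heis_bracket_basis\<close> below.\<close>

definition heis_bracket :: "('n::finite) heisenberg \<Rightarrow> 'n heisenberg \<Rightarrow> 'n heisenberg" where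
  "heis_bracket u v = (\<Sum>i\<in>UNIV. u $ X i * v $ Y i - u $ Y i * v $ X i) *s axis Z 1"

lemma card_heis_index: "CARD('n::finite heis_index) = 2 * CARD('n) + 1"
proof -
  have "card (range X \<union> range Y :: 'n heis_index set) = CARD('n) + CARD('n)"
    by (subst card_Un_disjoint) (auto simp: card_image inj_def)
  then show ?thesis
    by (subst UNIV_heis_index, subst card_insert_disjoint) auto
qed

lemma heisenberg_dim: "vec.dim (UNIV :: ('n::finite) heisenberg set) = 2 * CARD('n) + 1"
  by (simp add: vec.dim_UNIV vec.dimension_def card_cart_basis card_heis_index)

lemma axis_nth_if: "axis a c $ b = (if b = a then c else 0)"
  by (simp add: axis_def)

lemma heis_bracket_basis:
  fixes i j :: "'n::finite"
  shows "heis_bracket (axis (X i) 1) (axis (Y j) 1) = (if i = j then axis Z 1 else 0)"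
    and "heis_bracket (axis (Y j) 1) (axis (X i) 1) = (if i = j then - axis Z 1 else 0)"
    and "heis_bracket (axis (X i) 1) (axis (X j) 1) = 0"
    and "heis_bracket (axis (Y i) 1) (axis (Y j) 1) = 0"
    and "heis_bracket (axis Z 1) u = 0"
    and "heis_bracket u (axis Z 1) = 0"
proof -
  have *: "(\<Sum>k\<in>UNIV. (if k = i then 1 else 0) * (if k = j then 1 else (0::complex))) = (if i = j then 1 else 0)"
    by (simp add: if_distrib[of "\<lambda>x. x * _"] cong: if_cong)
  show "heis_bracket (axis (X i) 1) (axis (Y j) 1) = (if i = j then axis Z 1 else 0)"
    using * by (simp add: heis_bracket_def axis_nth_if)
  show "heis_bracket (axis (Y j) 1) (axis (X i) 1) = (if i = j then - axis Z 1 else 0)"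
    using * by (simp add: heis_bracket_def axis_nth_if sum_negf mult.commute)
qed (simp_all add: heis_bracket_def axis_nth_if)

lemma heis_bracket_X [simp]: "heis_bracket u v $ X i = 0"
  and heis_bracket_Y [simp]: "heis_bracket u v $ Y i = 0"
  by (simp_all add: heis_bracket_def axis_def)

lemma heis_bracket_bracket: "heis_bracket u (heis_bracket v w) = 0"
  by (subst heis_bracket_def) simp

lemma heis_bracket_add_left: "heis_bracket (u + v) w = heis_bracket u w + heis_bracket v w"
  unfolding heis_bracket_def vec.scale_left_distrib[symmetric] sum.distrib[symmetric]
  by (simp add: ring_distribs add_diff_add)

lemma heis_bracket_add_right: "heis_bracket w (u + v) = heis_bracket w u + heis_bracket w v"
  unfolding heis_bracket_def vec.scale_left_distrib[symmetric] sum.distrib[symmetric]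
  by (simp add: ring_distribs add_diff_add)

lemma heis_bracket_scale_left: "heis_bracket (a *s u) v = a *s heis_bracket u v"
  unfolding heis_bracket_def vec.scale_scale sum_distrib_left
  by (simp add: right_diff_distrib mult.assoc)

lemma heis_bracket_scale_right: "heis_bracket u (a *s v) = a *s heis_bracket u v"
  unfolding heis_bracket_def vec.scale_scale sum_distrib_left
  by (simp add: right_diff_distrib mult.left_commute)

lemma fd_complex_lie_algebra_heisenberg:
  "fd_complex_lie_algebra (*s) (heis_bracket :: ('n::finite) heisenberg \<Rightarrow> _)"
proof (unfold_locales, goal_cases)
  case 1
  show ?case using finite_cart_basis vec.span_Basis by blast
next
  case (2 y)
  show ?case by (rule heis_bracket_add_left)
next
  case (3 y a x)
  show ?case by (rule heis_bracket_scale_left)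
next
  case (4 x)
  show ?case by (rule heis_bracket_add_right)
next
  case (5 x a y)
  show ?case by (rule heis_bracket_scale_right)
next
  case (6 x)
  show ?case by (simp add: heis_bracket_def mult.commute)
next
  case (7 x y w)
  show ?case by (simp add: heis_bracket_bracket)
qed

interpretation heis: fd_complex_lie_algebra "(*s)" heis_bracket
  by (rule fd_complex_lie_algebra_heisenberg)

end

theory Submission
  imports Defs
begin

text \<open>
  The Heisenberg algebra is graded, with every \<open>x\<^sub>i\<close> and \<open>y\<^sub>i\<close> in degree
  \<open>1\<close> and \<open>z\<close> in degree \<open>2\<close>, so it carries the dilations that multiply degree
  \<open>k\<close> by \<open>t ^ k\<close>. These preserve the bracket and, for \<open>t \<noteq> 0\<close>, are
  automorphisms; \<open>dilation (inverse t)\<close> is the inverse. The Hom-Lie identity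
  costs nothing here: the algebra is two-step nilpotent, so every double bracket
  vanishes and \<^emph>\<open>any\<close> linear map is a Hom-Lie structure. Thus every dilation with
  \<open>t \<noteq> 0\<close> is regular. Since dilations compose by multiplying their parameters,
  one is involutive only if \<open>t\<^sup>2 = 1\<close>, and \<open>t = 2\<close> gives the required example.

  The inclusion of the involutive structures in the regular ones holds in every Lie
  algebra, because an involution is bijective; the dilation shows that it is strict.
\<close>

lemma (in fd_complex_lie_algebra) HLie_i_subset_HLie_r: "HLie_i \<subseteq> HLie_r"
  unfolding HLie_i_def HLie_r_def involutive_hom_lie_structure_def
    regular_hom_lie_structure_def lie_automorphism_def
    multiplicative_hom_lie_structure_def hom_lie_structure_def
  by (auto intro: o_bij)

lemma heis_hom_lie_structure_iff_linear:
  fixes D :: "('n::finite) heisenberg \<Rightarrow> 'n heisenberg"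
  shows "heis.hom_lie_structure D \<longleftrightarrow> Vector_Spaces.linear (*s) (*s) D"
  by (simp add: heis.hom_lie_structure_def heis_bracket_bracket)

definition dilation :: "complex \<Rightarrow> ('n::finite) heisenberg \<Rightarrow> 'n heisenberg" where
  "dilation t u = (\<chi> k. (if k = Z then t\<^sup>2 else t) * u $ k)"

lemma dilation_nth [simp]:
  "dilation t u $ Z = t\<^sup>2 * u $ Z"
  "dilation t u $ X i = t * u $ X i"
  "dilation t u $ Y i = t * u $ Y i"
  by (simp_all add: dilation_def)

lemma linear_dilation: "Vector_Spaces.linear (*s) (*s) (dilation t)"
  by unfold_locales (simp_all add: dilation_def vec_eq_iff distrib_left mult.left_commute)

lemma dilation_bracket:
  "dilation t (heis_bracket u v) = heis_bracket (dilation t u) (dilation t v)"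
proof -
  have "dilation t (heis_bracket u v) $ k = heis_bracket (dilation t u) (dilation t v) $ k" for k
    by (cases k)
      (simp_all add: heis_bracket_def axis_nth_if sum_distrib_left power2_eq_square algebra_simps)
  then show ?thesis
    by (simp add: vec_eq_iff)
qed

lemma dilation_dilation: "dilation s (dilation t u) = dilation (s * t) u"
  by (simp add: dilation_def vec_eq_iff power_mult_distrib)

lemma dilation_1: "dilation 1 u = u"
  by (simp add: dilation_def vec_eq_iff)

lemma bij_dilation:
  assumes "t \<noteq> 0"
  shows "bij (dilation t)"
  using assms
  by (intro o_bij[where g = "dilation (inverse t)"])
    (simp_all add: fun_eq_iff dilation_dilation dilation_1)

lemma regular_dilation:
  assumes "t \<noteq> 0"
  shows "heis.regular_hom_lie_structure (dilation t)"
  using assms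
  by (simp add: heis.regular_hom_lie_structure_def heis.multiplicative_hom_lie_structure_def
      heis.lie_automorphism_def heis_hom_lie_structure_iff_linear linear_dilation
      bij_dilation dilation_bracket)

text \<open>The parameter is read off from a coordinate of degree one; that of \<open>z\<close> would
  only give its square.\<close>

lemma dilation_eq_iff:
  "(dilation s :: ('n::finite) heisenberg \<Rightarrow> _) = dilation t \<longleftrightarrow> s = t"
proof
  assume "(dilation s :: 'n heisenberg \<Rightarrow> _) = dilation t"
  then have "dilation s (axis (X i) 1) $ X i = dilation t (axis (X i) 1) $ X i" for i :: 'n
    by simp
  then show "s = t"
    by (simp add: axis_nth_if)
qed simp

lemma nontrivial_dilation:
  assumes "t \<noteq> 0" "t \<noteq> 1"
  shows "heis.nontrivial (dilation t :: ('n::finite) heisenberg \<Rightarrow> _)"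
proof -
  have "(\<lambda>_. 0) = (dilation 0 :: 'n heisenberg \<Rightarrow> _)" "id = (dilation 1 :: 'n heisenberg \<Rightarrow> _)"
    by (simp_all add: fun_eq_iff dilation_1 dilation_def vec_eq_iff)
  with assms show ?thesis
    unfolding heis.nontrivial_def by (metis dilation_eq_iff)
qed

lemma involutive_dilationD:
  assumes "heis.involutive_hom_lie_structure (dilation t :: ('n::finite) heisenberg \<Rightarrow> _)"
  shows "t * t = 1"
proof -
  have "dilation t \<circ> dilation t = (id :: 'n heisenberg \<Rightarrow> _)"
    using assms by (simp add: heis.involutive_hom_lie_structure_def)
  then have "(dilation (t * t) :: 'n heisenberg \<Rightarrow> _) = dilation 1"
    by (simp add: fun_eq_iff dilation_dilation dilation_1)
  then show ?thesis
    by (simp add: dilation_eq_iff)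
qed

theorem corollary4p4:
  shows "(\<exists>D :: ('n::finite) heisenberg \<Rightarrow> 'n heisenberg.
            heis.regular_hom_lie_structure D \<and> heis.nontrivial D \<and>
            \<not> heis.involutive_hom_lie_structure D) \<and>
         (heis.HLie_i :: ('n heisenberg \<Rightarrow> 'n heisenberg) set) \<subset> heis.HLie_r"
proof -
  let ?D = "dilation 2 :: 'n heisenberg \<Rightarrow> 'n heisenberg"
  have regular: "heis.regular_hom_lie_structure ?D"
    by (simp add: regular_dilation)
  have nontrivial: "heis.nontrivial ?D"
    by (simp add: nontrivial_dilation)
  have not_involutive: "\<not> heis.involutive_hom_lie_structure ?D"
    using involutive_dilationD[where t = 2] by auto
  have "?D \<in> heis.HLie_r - heis.HLie_i"
    using regular not_involutive by (simp add: heis.HLie_r_def heis.HLie_i_def)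
  then have "(heis.HLie_i :: ('n heisenberg \<Rightarrow> 'n heisenberg) set) \<subset> heis.HLie_r"
    using heis.HLie_i_subset_HLie_r by blast
  with regular nontrivial not_involutive show ?thesis
    by blast
qed

end
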